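(* Let $a<b$ be real numbers, let $p>1$ and $q$ be real numbers with $\frac1p+\frac1q=1$, and let $r,s$ be positive measurable functions on the interval $(a,b)$. Put $R(a,x)=\int_a^x r(t)\,dt$ and suppose that $\int_a^b\left(1/R(a,x)\right)^{p-1}dx<\infty$. Then for all measurable functions $f\ge 0$ on $(a,b)$ such that all integrals below exist and are finite, $$\int_a^b r(x)\left(\int_x^b f(t)\,dt\right)^2dx\le \sup_{a<x<b}R(a,x)\,\left(\int_a^b\left(\frac1{s(x)}\right)^{p-1}dx\right)^{\frac2p}\left(\int_a^b s(x)\,(f(x))^q\,dx\right)^{\frac2q}.$$
   Context: Standing assumption: all functions are measurable and all the integrals appearing in the inequality (including those defining $R(a,x)$ and $\int_x^b f$ for $x\in(a,b)$) exist and are finite. The supremum is taken in $[0,+\infty]$, with $0\cdot\infty=0$. *)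

theory Defs
  imports "HOL-Analysis.Analysis"
begin

definition R :: "(real \<Rightarrow> real) \<Rightarrow> real \<Rightarrow> real \<Rightarrow> real" where
  "R r a x = (LINT t:{a<..<x}|lebesgue. r t)"

end

theory Submission
  imports Defs
begin

text \<open>By Hoelder's inequality applied to \<open>f = s powr (-1/q) * (s powr (1/q) * f)\<close>, the function \<open>f\<close> is
  integrable over the whole interval, and the square of its integral \<open>I\<close> is at most the product of the
  last two factors on the right. Since \<open>f \<ge> 0\<close>, the inner integral is at most \<open>I\<close> for every \<open>x\<close>, so
  the left-hand side is at most \<open>I\<^sup>2\<close> times the integral of \<open>r\<close> over \<open>(a,b)\<close>, which by monotone
  convergence is the supremum of \<open>R(a,x)\<close>.\<close>

text \<open>Young's inequality supplies the integrable majorant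
  \<open>u x powr p / p + v x powr q / q\<close>. Integrability matters separately from the Hoelder
  bound, since the Bochner integral of a non-integrable function is 0 by default and a bound on it
  would say nothing.\<close>

lemma integrable_mult_conjugate_exponents:
  fixes u v :: "'a \<Rightarrow> real"
  assumes pq: "p > 1" "q > 1" "1 / p + 1 / q = 1"
    and [measurable]: "u \<in> borel_measurable M" "v \<in> borel_measurable M"
    and nonneg: "\<And>x. x \<in> space M \<Longrightarrow> u x \<ge> 0" "\<And>x. x \<in> space M \<Longrightarrow> v x \<ge> 0"
    and int: "integrable M (\<lambda>x. u x powr p)" "integrable M (\<lambda>x. v x powr q)"
  shows "integrable M (\<lambda>x. u x * v x)"
proof (rule Bochner_Integration.integrable_bound)
  show "integrable M (\<lambda>x. u x powr p / p + v x powr q / q)"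
    using int by simp
  show "AE x in M. norm (u x * v x) \<le> norm (u x powr p / p + v x powr q / q)"
  proof (rule AE_I2)
    fix x assume "x \<in> space M"
    then show "norm (u x * v x) \<le> norm (u x powr p / p + v x powr q / q)"
      using Youngs_inequality[OF pq, of "u x" "v x"] nonneg by force
  qed
qed measurable

text \<open>Scale both factors to norm 1, apply Young's inequality pointwise and integrate. The
  scaling divides by the norms, so a vanishing norm is treated separately: there the product is zero
  almost everywhere.\<close>

lemma Hoelder_inequality_integral:
  fixes u v :: "'a \<Rightarrow> real"
  assumes pq: "p > 1" "q > 1" "1 / p + 1 / q = 1"
    and meas [measurable]: "u \<in> borel_measurable M" "v \<in> borel_measurable M"
    and nonneg: "\<And>x. x \<in> space M \<Longrightarrow> u x \<ge> 0" "\<And>x. x \<in> space M \<Longrightarrow> v x \<ge> 0"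
    and int: "integrable M (\<lambda>x. u x powr p)" "integrable M (\<lambda>x. v x powr q)"
  shows "(\<integral>x. u x * v x \<partial>M) \<le> (\<integral>x. u x powr p \<partial>M) powr (1 / p) * (\<integral>x. v x powr q \<partial>M) powr (1 / q)"
proof -
  define A where "A = (\<integral>x. u x powr p \<partial>M)"
  define B where "B = (\<integral>x. v x powr q \<partial>M)"
  have int_uv: "integrable M (\<lambda>x. u x * v x)"
    using integrable_mult_conjugate_exponents[OF pq meas nonneg int] .
  have "A \<ge> 0" "B \<ge> 0"
    by (simp_all add: A_def B_def)
  then consider "A = 0" | "B = 0" | "A > 0" "B > 0"
    by linarith
  then show ?thesis
  proof cases
    case 1
    then have "AE x in M. u x powr p = 0"
      using integral_nonneg_eq_0_iff_AE[OF int(1)] by (simp add: A_def)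
    \<comment> \<open>A power \<open>u x powr p\<close> vanishes only where \<open>u x\<close>
      does.\<close>
    then have "AE x in M. u x * v x = 0"
      by eventually_elim simp
    then have "(\<integral>x. u x * v x \<partial>M) = 0"
      by (rule integral_eq_zero_AE)
    then show ?thesis by simp
  next
    case 2
    then have "AE x in M. v x powr q = 0"
      using integral_nonneg_eq_0_iff_AE[OF int(2)] by (simp add: B_def)
    then have "AE x in M. u x * v x = 0"
      by eventually_elim simp
    then have "(\<integral>x. u x * v x \<partial>M) = 0"
      by (rule integral_eq_zero_AE)
    then show ?thesis by simp
  next
    case 3
    \<comment> \<open>The product of the two norms; dividing by \<open>C\<close> normalises both
      factors at once.\<close>
    define C where "C = A powr (1 / p) * B powr (1 / q)"
    have "C > 0"
      using 3 by (simp add: C_def)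
    have "(\<integral>x. u x * v x / C \<partial>M) \<le> (\<integral>x. u x powr p / (A * p) + v x powr q / (B * q) \<partial>M)"
    proof (rule integral_mono)
      fix x assume x: "x \<in> space M"
      have "u x / A powr (1 / p) * (v x / B powr (1 / q))
          \<le> (u x / A powr (1 / p)) powr p / p + (v x / B powr (1 / q)) powr q / q"
        using nonneg[OF x] by (intro Youngs_inequality pq) auto
      also have "\<dots> = u x powr p / (A * p) + v x powr q / (B * q)"
        using nonneg[OF x] 3 pq by (simp add: powr_divide powr_powr)
      finally show "u x * v x / C \<le> u x powr p / (A * p) + v x powr q / (B * q)"
        by (simp add: C_def)
    qed (use int int_uv in auto)
    also have "\<dots> = A / (A * p) + B / (B * q)"
      using int by (simp add: A_def B_def)
    \<comment> \<open>After cancelling \<open>A\<close> and \<open>B\<close>, the sum is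
      \<open>1 / p + 1 / q\<close>.\<close>
    also have "\<dots> = 1"
      using 3 pq by simp
    finally have "(\<integral>x. u x * v x \<partial>M) / C \<le> 1"
      by simp
    then show ?thesis
      using \<open>C > 0\<close> by (simp add: C_def A_def B_def)
  qed
qed

text \<open>Exhaust the interval by \<open>{a<..<c n}\<close> with \<open>c n\<close> increasing to
  \<open>b\<close> and use monotone convergence. Both sides live in \<open>ennreal\<close> because
  \<open>r\<close> is assumed integrable only up to each \<open>x < b\<close>, so both may be
  infinite.\<close>

lemma nn_integral_le_SUP_set_integral_greaterThanLessThan:
  fixes r :: "real \<Rightarrow> real"
  assumes ab: "a < b"
    and meas: "r \<in> borel_measurable (lebesgue_on {a<..<b})"
    and nonneg: "\<And>x. x \<in> {a<..<b} \<Longrightarrow> r x \<ge> 0"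
    and int: "\<And>x. x \<in> {a<..<b} \<Longrightarrow> set_integrable lebesgue {a<..<x} r"
  shows "(\<integral>\<^sup>+x. ennreal (r x) \<partial>lebesgue_on {a<..<b})
    \<le> (SUP x\<in>{a<..<b}. ennreal (LINT t:{a<..<x}|lebesgue. r t))"
proof -
  \<comment> \<open>The shift by 2 keeps every point strictly inside: with \<open>n + 1\<close> the
    first point would be \<open>a\<close> itself.\<close>
  define c where "c n = b - (b - a) / real (n + 2)" for n :: nat
  have c: "c n \<in> {a<..<b}" for n
  proof -
    have "(b - a) / real (n + 2) < (b - a) / 1"
      using ab by (intro divide_strict_left_mono) auto
    moreover have "0 < (b - a) / real (n + 2)"
      using ab by (intro divide_pos_pos) auto
    ultimately show ?thesis
      by (auto simp: c_def)
  qed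
  have mono_c: "c m \<le> c n" if "m \<le> n" for m n
    unfolding c_def using ab that by (intro diff_left_mono divide_left_mono) auto
  have lim_c: "c \<longlonglongrightarrow> b"
    unfolding c_def by real_asymp
  define g where "g n x = ennreal (r x) * indicator {a<..<c n} x" for n x
  have g_meas: "g n \<in> borel_measurable (lebesgue_on {a<..<b})" for n
  proof -
    have "{a<..<c n} \<in> sets (lebesgue_on {a<..<b})"
      using c[of n] by (subst sets_restrict_space_iff) auto
    then show ?thesis
      using meas unfolding g_def by measurable
  qed
  have g_int: "integral\<^sup>N (lebesgue_on {a<..<b}) (g n) = ennreal (LINT t:{a<..<c n}|lebesgue. r t)" for n
  proof -
    have "integral\<^sup>N (lebesgue_on {a<..<b}) (g n)
        = (\<integral>\<^sup>+x. ennreal (indicator {a<..<c n} x *\<^sub>R r x) \<partial>lebesgue)"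
      using c[of n] by (subst nn_integral_restrict_space)
        (auto intro!: nn_integral_cong simp: g_def split: split_indicator)
    also have "\<dots> = ennreal (LINT t:{a<..<c n}|lebesgue. r t)"
      unfolding set_lebesgue_integral_def
      using int[OF c] nonneg c[of n]
      by (intro nn_integral_eq_integral) (auto simp: set_integrable_def split: split_indicator)
    finally show ?thesis .
  qed
  have "(\<integral>\<^sup>+x. ennreal (r x) \<partial>lebesgue_on {a<..<b}) = (\<integral>\<^sup>+x. (SUP n. g n x) \<partial>lebesgue_on {a<..<b})"
  proof (rule nn_integral_cong)
    fix x assume "x \<in> space (lebesgue_on {a<..<b})"
    then have x: "x \<in> {a<..<b}"
      by simp
    \<comment> \<open>The supremum is attained: once \<open>c n\<close> has passed \<open>x\<close>,
      the truncation \<open>g n\<close> agrees with \<open>r\<close> at \<open>x\<close>.\<close>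
    then have "eventually (\<lambda>n. c n > x) sequentially"
      using order_tendstoD(1)[OF lim_c] by simp
    then obtain n where "x < c n"
      by (auto simp: eventually_sequentially)
    then have "ennreal (r x) = g n x"
      using x by (simp add: g_def)
    moreover have "g m x \<le> ennreal (r x)" for m
      using nonneg[OF x] by (auto simp: g_def split: split_indicator)
    ultimately show "ennreal (r x) = (SUP n. g n x)"
      by (intro antisym SUP_least) (auto intro: SUP_upper)
  qed
  also have "\<dots> = (SUP n. integral\<^sup>N (lebesgue_on {a<..<b}) (g n))"
  proof (rule nn_integral_monotone_convergence_SUP[OF _ g_meas])
    show "incseq g"
    proof (intro incseq_SucI le_funI)
      fix n x
      show "g n x \<le> g (Suc n) x"
        using mono_c[of n "Suc n"] by (auto simp: g_def split: split_indicator)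
    qed
  qed
  also have "\<dots> \<le> (SUP x\<in>{a<..<b}. ennreal (LINT t:{a<..<x}|lebesgue. r t))"
    unfolding g_int using c by (intro SUP_least SUP_upper)
  finally show ?thesis .
qed

theorem theorem2p8:
  fixes a b p q :: real and r s f :: "real \<Rightarrow> real"
  assumes ab: "a < b"
    and p: "p > 1"
    and pq: "1 / p + 1 / q = 1"
    and r_meas: "r \<in> borel_measurable (lebesgue_on {a<..<b})"
    and s_meas: "s \<in> borel_measurable (lebesgue_on {a<..<b})"
    and r_pos: "\<And>x. x \<in> {a<..<b} \<Longrightarrow> r x > 0"
    and s_pos: "\<And>x. x \<in> {a<..<b} \<Longrightarrow> s x > 0"
    and R_fin: "\<And>x. x \<in> {a<..<b} \<Longrightarrow> set_integrable lebesgue {a<..<x} r"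
    and R_inv: "set_integrable lebesgue {a<..<b} (\<lambda>x. (1 / R r a x) powr (p - 1))"
    and f_meas: "f \<in> borel_measurable (lebesgue_on {a<..<b})"
    and f_nonneg: "\<And>x. x \<in> {a<..<b} \<Longrightarrow> f x \<ge> 0"
    and f_fin: "\<And>x. x \<in> {a<..<b} \<Longrightarrow> set_integrable lebesgue {x<..<b} f"
    and lhs_fin: "set_integrable lebesgue {a<..<b}
          (\<lambda>x. r x * (LINT t:{x<..<b}|lebesgue. f t)\<^sup>2)"
    and s_fin: "set_integrable lebesgue {a<..<b} (\<lambda>x. (1 / s x) powr (p - 1))"
    and sf_fin: "set_integrable lebesgue {a<..<b} (\<lambda>x. s x * f x powr q)"
  shows "ennreal (LINT x:{a<..<b}|lebesgue. r x * (LINT t:{x<..<b}|lebesgue. f t)\<^sup>2)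
    \<le> (SUP x\<in>{a<..<b}. ennreal (R r a x))
      * ennreal ((LINT x:{a<..<b}|lebesgue. (1 / s x) powr (p - 1)) powr (2 / p))
      * ennreal ((LINT x:{a<..<b}|lebesgue. s x * f x powr q) powr (2 / q))"
proof -
  let ?M = "lebesgue_on {a<..<b}"
  note restrict = integral_restrict_space[of "{a<..<b}" lebesgue, simplified]
  have q: "q > 1"
  proof -
    have "0 < 1 / p" "1 / p < 1"
      using p by simp_all
    with pq have "0 < 1 / q" "1 / q < 1"
      by linarith+
    then show ?thesis
      by (simp add: divide_less_eq split: if_splits)
  qed
  \<comment> \<open>This identity turns the p-th power of \<open>s powr (-1/q)\<close> into the
    weight \<open>(1 / s x) powr (p - 1)\<close> of the statement.\<close>
  have pq': "p / q = p - 1"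
    using p q pq by (simp add: field_simps)
  note [measurable] = r_meas s_meas f_meas
  define I where "I = (\<integral>x. f x \<partial>?M)"
  define A where "A = (LINT x:{a<..<b}|lebesgue. (1 / s x) powr (p - 1))"
  define B where "B = (LINT x:{a<..<b}|lebesgue. s x * f x powr q)"
  let ?u = "\<lambda>x. (1 / s x) powr (1 / q)" and ?v = "\<lambda>x. s x powr (1 / q) * f x"
  have u: "?u x powr p = (1 / s x) powr (p - 1)" for x
    by (simp add: powr_powr pq')
  \<comment> \<open>This identity and \<open>uv\<close> rely on the sign conditions on
    \<open>s\<close> and \<open>f\<close>, so they hold on the interval only and enter the integrals
    through congruence rules.\<close>
  have v: "?v x powr q = s x * f x powr q" if "x \<in> {a<..<b}" for x
    using s_pos[OF that] f_nonneg[OF that] q by (simp add: powr_mult powr_powr)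
  have uv: "?u x * ?v x = f x" if "x \<in> {a<..<b}" for x
    using s_pos[OF that] by (simp add: powr_divide)
  have u_int: "integrable ?M (\<lambda>x. ?u x powr p)"
    using s_fin unfolding u by (simp add: set_integrable_eq)
  have v_int: "integrable ?M (\<lambda>x. ?v x powr q)"
    using sf_fin
    by (subst Bochner_Integration.integrable_cong[OF refl v]) (simp_all add: set_integrable_eq)
  have A: "A = (\<integral>x. ?u x powr p \<partial>?M)"
    unfolding A_def u by (simp add: set_lebesgue_integral_def restrict)
  have B: "B = (\<integral>x. ?v x powr q \<partial>?M)"
    unfolding B_def
    by (subst Bochner_Integration.integral_cong[OF refl v])
      (simp_all add: set_lebesgue_integral_def restrict)
  \<comment> \<open>The assumption \<open>f_fin\<close> stops short of the endpoint
    \<open>a\<close>; integrability up to \<open>a\<close> comes from the two weighted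
    integrals.\<close>
  have f_int: "integrable ?M f"
    using integrable_mult_conjugate_exponents[OF p q pq _ _ _ _ u_int v_int] uv f_nonneg
    by (subst Bochner_Integration.integrable_cong[OF refl uv[symmetric]]) auto
  have "I = (\<integral>x. ?u x * ?v x \<partial>?M)"
    unfolding I_def by (intro Bochner_Integration.integral_cong refl) (simp add: uv)
  also have "\<dots> \<le> A powr (1 / p) * B powr (1 / q)"
    unfolding A B using f_nonneg
    by (intro Hoelder_inequality_integral p q pq u_int v_int) auto
  finally have I_le: "I \<le> A powr (1 / p) * B powr (1 / q)" .
  have "I \<ge> 0"
    unfolding I_def using f_nonneg by (intro integral_nonneg_AE AE_I2) simp
  with I_le have "I\<^sup>2 \<le> (A powr (1 / p) * B powr (1 / q))\<^sup>2"
    by (intro power_mono)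
  also have "\<dots> = A powr (2 / p) * B powr (2 / q)"
    by (simp add: power2_eq_square powr_add[symmetric] ac_simps)
  finally have I2_le: "I\<^sup>2 \<le> A powr (2 / p) * B powr (2 / q)" .

  have tail: "0 \<le> (LINT t:{x<..<b}|lebesgue. f t)" "(LINT t:{x<..<b}|lebesgue. f t) \<le> I"
    if "x \<in> {a<..<b}" for x
  proof -
    show "0 \<le> (LINT t:{x<..<b}|lebesgue. f t)"
      unfolding set_lebesgue_integral_def using that f_nonneg
      by (intro integral_nonneg_AE AE_I2) (auto split: split_indicator)
    have "I = (LINT t:{a<..<b}|lebesgue. f t)"
      by (simp add: I_def set_lebesgue_integral_def restrict)
    \<comment> \<open>Monotonicity of the Bochner integral needs both sides integrable:
      \<open>f_fin\<close> covers the tail, \<open>f_int\<close> the whole interval.\<close>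
    moreover have "(LINT t:{x<..<b}|lebesgue. f t) \<le> (LINT t:{a<..<b}|lebesgue. f t)"
      unfolding set_lebesgue_integral_def using that f_nonneg f_fin[OF that] f_int
      by (intro integral_mono)
        (auto simp: set_integrable_def integrable_restrict_space split: split_indicator)
    ultimately show "(LINT t:{x<..<b}|lebesgue. f t) \<le> I"
      by simp
  qed
  \<comment> \<open>From here on the integrals are nonnegative extended ones: after bounding the
    tail by \<open>I\<close>, the factor \<open>r\<close> alone may have infinite integral. If
    moreover \<open>I = 0\<close>, the convention that 0 times infinity is 0 keeps the chain
    valid.\<close>
  have "ennreal (LINT x:{a<..<b}|lebesgue. r x * (LINT t:{x<..<b}|lebesgue. f t)\<^sup>2)
      = ennreal (\<integral>x. r x * (LINT t:{x<..<b}|lebesgue. f t)\<^sup>2 \<partial>?M)"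
    unfolding restrict set_lebesgue_integral_def[of lebesgue "{a<..<b}"] by simp
  also have "\<dots> = (\<integral>\<^sup>+x. ennreal (r x * (LINT t:{x<..<b}|lebesgue. f t)\<^sup>2) \<partial>?M)"
    using lhs_fin r_pos
    by (intro nn_integral_eq_integral[symmetric] AE_I2) (auto simp: set_integrable_eq less_imp_le)
  also have "\<dots> \<le> (\<integral>\<^sup>+x. ennreal (r x) * ennreal (I\<^sup>2) \<partial>?M)"
  proof (rule nn_integral_mono)
    fix x assume "x \<in> space ?M"
    then have x: "x \<in> {a<..<b}"
      by simp
    have "r x * (LINT t:{x<..<b}|lebesgue. f t)\<^sup>2 \<le> r x * I\<^sup>2"
      using r_pos[OF x] tail[OF x] by (intro mult_left_mono power_mono) auto
    then show "ennreal (r x * (LINT t:{x<..<b}|lebesgue. f t)\<^sup>2) \<le> ennreal (r x) * ennreal (I\<^sup>2)"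
      using r_pos[OF x] by (simp add: ennreal_mult[symmetric] ennreal_leI)
  qed
  also have "\<dots> = (\<integral>\<^sup>+x. ennreal (r x) \<partial>?M) * ennreal (I\<^sup>2)"
    by (rule nn_integral_multc) measurable
  \<comment> \<open>The two factors are bounded independently: the integral of \<open>r\<close> by
    the supremum, and \<open>I\<^sup>2\<close> by the squared Hoelder bound.\<close>
  also have "\<dots> \<le> (SUP x\<in>{a<..<b}. ennreal (R r a x)) * ennreal (A powr (2 / p) * B powr (2 / q))"
    unfolding R_def using ab r_meas r_pos R_fin I2_le
    by (intro mult_mono nn_integral_le_SUP_set_integral_greaterThanLessThan ennreal_leI)
      (auto simp: less_imp_le)
  finally show ?thesis
    by (simp add: A_def B_def ennreal_mult mult.assoc)
qed

end
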